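(* Let $p\ge 1$ be a fixed real number and let $l_+^p$ be the set of all sequences $x=(\eta_1,\eta_2,\eta_3,\ldots)$ of nonnegative real numbers such that $\sum_{i=1}^\infty(\eta_i)^p<\infty$, equipped with the metric $d(x,y)=\left[\sum_{i=1}^\infty c_i^{\,p}\right]^{1/p}$, where, for $x=(\eta_i)$ and $y=(\mu_i)$ in $l_+^p$, $c_i$ is the nonnegative real number determined by $\max\{\eta_i,\mu_i\}=\min\{\eta_i,\mu_i\}+c_i$ (so $c_i=0$ if $\eta_i=\mu_i$). Then the metric space $(l_+^p,d)$ is complete. *)

theory Defs
  imports "HOL-Analysis.Analysis"
begin

(* Sequences are indexed from 0, so x i stands for the term of index i + 1.
   Since 0 powr p = 0, powr agrees with the usual p-th power on all
   nonnegative reals when p > 0. *)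

definition lp_plus :: "real \<Rightarrow> (nat \<Rightarrow> real) set" where
  "lp_plus p = {x. (\<forall>i. 0 \<le> x i) \<and> summable (\<lambda>i. x i powr p)}"

definition gap :: "real \<Rightarrow> real \<Rightarrow> real" where
  "gap a b = (THE c. 0 \<le> c \<and> max a b = min a b + c)"

(* The series converges whenever x and y lie in lp_plus p with p \<ge> 1;
   elsewhere lp_dist is still nonnegative and symmetric, which the locale
   Metric_space demands on the whole type. *)
definition lp_dist :: "real \<Rightarrow> (nat \<Rightarrow> real) \<Rightarrow> (nat \<Rightarrow> real) \<Rightarrow> real" where
  "lp_dist p x y = (\<Sum>i. gap (x i) (y i) powr p) powr (1 / p)"

end

theory Submission
  imports Defs
begin

text \<open>
  The number \<open>c\<^sub>i\<close> is \<open>\<bar>\<eta>\<^sub>i - \<mu>\<^sub>i\<bar>\<close>, so \<open>d\<close> is the usual \<open>\<ell>\<^sup>p\<close> distance, and the triangle inequality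
  is Minkowski's, which follows from convexity of \<open>t \<mapsto> t\<^sup>p\<close>. A Cauchy sequence converges
  coordinatewise to a nonnegative sequence; passing to the limit in the partial sums of the
  distance shows that it converges in \<open>d\<close> as well.
\<close>

section \<open>Convexity of powers and the finite Minkowski inequality\<close>

lemma gap_eq: "gap a b = \<bar>a - b\<bar>"
  unfolding gap_def by (rule the_equality) auto

text \<open>For positive \<open>x\<close> and \<open>y\<close> this is \<open>powr_convex\<close>.
  If one of them is 0, a single term is left and the claim becomes \<open>scale\<close>, which holds
  because \<open>s powr p \<le> s\<close> on [0, 1].\<close>

lemma powr_convex_nonneg:
  fixes p t x y :: real
  assumes p: "p \<ge> 1" and t: "0 \<le> t" "t \<le> 1" and xy: "0 \<le> x" "0 \<le> y"
  shows "((1 - t) * x + t * y) powr p \<le> (1 - t) * x powr p + t * y powr p"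
proof -
  have scale: "(s * z) powr p \<le> s * z powr p" if "0 \<le> s" "s \<le> 1" "0 \<le> z" for s z :: real
  proof -
    have "s powr p \<le> s powr 1" if "0 < s"
      using p that \<open>s \<le> 1\<close> by (intro powr_mono') auto
    then have "s powr p \<le> s"
      using that by (cases "s = 0") auto
    then show ?thesis
      using that by (simp add: powr_mult mult_right_mono)
  qed
  consider "x = 0" | "y = 0" | "x > 0" "y > 0"
    using xy by linarith
  then show ?thesis
  proof cases
    case 1
    then show ?thesis using scale[of t y] t xy by simp
  next
    case 2
    then show ?thesis using scale[of "1 - t" x] t xy by simp
  next
    case 3
    then show ?thesis
      using convex_onD[OF powr_convex[OF p], of t x y] t by simp
  qed
qed

text \<open>After normalisation, \<open>(a i + b i) / (A + B)\<close> is the convex combination of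
  \<open>a i / A\<close> and \<open>b i / B\<close> with weights \<open>A / (A + B)\<close> and
  \<open>B / (A + B)\<close>. Convexity in each coordinate, summed over \<open>I\<close>, leaves
  \<open>(1 - t) + t = 1\<close> as the factor of \<open>(A + B) powr p\<close>. Positive upper
  bounds \<open>A\<close> and \<open>B\<close> stand in for the norms so that the divisions make
  sense.\<close>

lemma Minkowski_sum_le:
  fixes a b :: "'i \<Rightarrow> real"
  assumes p: "p \<ge> 1" and a: "\<And>i. 0 \<le> a i" and b: "\<And>i. 0 \<le> b i"
    and A: "0 < A" "(\<Sum>i\<in>I. a i powr p) \<le> A powr p"
    and B: "0 < B" "(\<Sum>i\<in>I. b i powr p) \<le> B powr p"
  shows "(\<Sum>i\<in>I. (a i + b i) powr p) \<le> (A + B) powr p"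
proof -
  define t where "t = B / (A + B)"
  have t: "0 \<le> t" "t \<le> 1"
    using A B by (auto simp: t_def)
  have pt: "(a i + b i) powr p \<le>
      (A + B) powr p * ((1 - t) / A powr p * a i powr p + t / B powr p * b i powr p)" for i
  proof -
    have "a i + b i = (A + B) * ((1 - t) * (a i / A) + t * (b i / B))"
    proof -
      have "(A + B) * (1 - t) = A" "(A + B) * t = B"
        using A B by (auto simp: t_def right_diff_distrib)
      then show ?thesis
        using A B by (simp add: distrib_left mult.assoc[symmetric])
    qed
    then have "(a i + b i) powr p = (A + B) powr p * ((1 - t) * (a i / A) + t * (b i / B)) powr p"
      using A B a b t by (simp add: powr_mult)
    also have "\<dots> \<le> (A + B) powr p * ((1 - t) * (a i / A) powr p + t * (b i / B) powr p)"
      using A B a b t p by (intro mult_left_mono powr_convex_nonneg) auto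
    finally show ?thesis
      using A B a b by (simp add: powr_divide)
  qed
  have "(\<Sum>i\<in>I. (a i + b i) powr p) \<le>
      (A + B) powr p * ((1 - t) / A powr p * (\<Sum>i\<in>I. a i powr p) + t / B powr p * (\<Sum>i\<in>I. b i powr p))"
    unfolding sum_distrib_left sum.distrib[symmetric] by (intro sum_mono pt)
  also have "\<dots> \<le> (A + B) powr p * ((1 - t) / A powr p * A powr p + t / B powr p * B powr p)"
    using A B t by (intro mult_left_mono add_mono) auto
  also have "\<dots> = (A + B) powr p"
    using A B by simp
  finally show ?thesis .
qed

section \<open>The norm of an infinite sequence\<close>

text \<open>No absolute value is taken inside, so this is the usual norm for nonnegative sequences
  with convergent series; differences enter as \<open>\<bar>x i - y i\<bar>\<close>.\<close>

definition p_norm :: "real \<Rightarrow> (nat \<Rightarrow> real) \<Rightarrow> real" where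
  "p_norm p a = (\<Sum>i. a i powr p) powr (1 / p)"

lemma p_norm_nonneg: "0 \<le> p_norm p a"
  by (simp add: p_norm_def)

lemma lp_dist_eq_p_norm: "lp_dist p x y = p_norm p (\<lambda>i. \<bar>x i - y i\<bar>)"
  by (simp add: lp_dist_def p_norm_def gap_eq)

lemma sum_powr_le_p_norm:
  assumes "p \<ge> 1" "summable (\<lambda>i. a i powr p)" "finite I"
  shows "(\<Sum>i\<in>I. a i powr p) \<le> p_norm p a powr p"
proof -
  have "(\<Sum>i\<in>I. a i powr p) \<le> (\<Sum>i. a i powr p)"
    using assms by (intro sum_le_suminf) auto
  also have "\<dots> = p_norm p a powr p"
    using assms suminf_nonneg[OF assms(2)] by (simp add: p_norm_def powr_powr)
  finally show ?thesis .
qed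

lemma le_p_norm:
  assumes "p \<ge> 1" "summable (\<lambda>i. a i powr p)"
  shows "a i \<le> p_norm p a"
proof (rule ccontr)
  assume "\<not> a i \<le> p_norm p a"
  then have "p_norm p a powr p < a i powr p"
    using assms(1) p_norm_nonneg by (intro powr_less_mono2) auto
  then show False
    using sum_powr_le_p_norm[OF assms(1,2), of "{i}"] by simp
qed

text \<open>Converse of \<open>sum_powr_le_p_norm\<close>: the terms are nonnegative, so bounded
  partial sums give convergence, and the bound passes to the infinite sum. Norm estimates thus
  reduce to finite sums.\<close>

lemma p_norm_le:
  assumes "p \<ge> 1" "0 \<le> r" "\<And>n. (\<Sum>i<n. a i powr p) \<le> r powr p"
  shows "summable (\<lambda>i. a i powr p)" "p_norm p a \<le> r"
proof -
  show s: "summable (\<lambda>i. a i powr p)"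
    using assms(3) by (intro summableI_nonneg_bounded) auto
  have "(\<Sum>i. a i powr p) powr (1 / p) \<le> (r powr p) powr (1 / p)"
    using assms by (intro powr_mono2 suminf_le_const suminf_nonneg s) auto
  then show "p_norm p a \<le> r"
    using assms by (simp add: p_norm_def powr_powr)
qed

lemma p_norm_add:
  assumes p: "p \<ge> 1" and a: "\<And>i. 0 \<le> a i" "summable (\<lambda>i. a i powr p)"
    and b: "\<And>i. 0 \<le> b i" "summable (\<lambda>i. b i powr p)"
  shows "summable (\<lambda>i. (a i + b i) powr p)"
    and "p_norm p (\<lambda>i. a i + b i) \<le> p_norm p a + p_norm p b"
proof -
  \<comment> \<open>Enlarging both norms by \<open>e\<close> avoids treating vanishing norms separately.\<close>
  have le: "(\<Sum>i<n. (a i + b i) powr p) \<le> ((p_norm p a + e) + (p_norm p b + e)) powr p"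
    if "e > 0" for e n
  proof (rule Minkowski_sum_le[OF p a(1) b(1)])
    have mono: "(\<Sum>i<n. c i powr p) \<le> (p_norm p c + e) powr p"
      if "summable (\<lambda>i. c i powr p)" for c
    proof -
      have "p_norm p c powr p \<le> (p_norm p c + e) powr p"
        using p \<open>e > 0\<close> p_norm_nonneg[of p c] by (intro powr_mono2) auto
      then show ?thesis
        using sum_powr_le_p_norm[OF p that, of "{..<n}"] by simp
    qed
    show "(\<Sum>i<n. a i powr p) \<le> (p_norm p a + e) powr p"
      "(\<Sum>i<n. b i powr p) \<le> (p_norm p b + e) powr p"
      using mono a b by auto
  qed (use that p_norm_nonneg[of p a] p_norm_nonneg[of p b] in auto)
  \<comment> \<open>One value of \<open>e\<close> suffices for convergence; the norm bound lets
    \<open>e\<close> tend to 0.\<close>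
  show "summable (\<lambda>i. (a i + b i) powr p)"
    using p_norm_le(1)[OF p _ le[of 1]] p_norm_nonneg[of p a] p_norm_nonneg[of p b] by simp
  show "p_norm p (\<lambda>i. a i + b i) \<le> p_norm p a + p_norm p b"
  proof (rule field_le_epsilon)
    fix e :: real assume "e > 0"
    then show "p_norm p (\<lambda>i. a i + b i) \<le> p_norm p a + p_norm p b + e"
      using p_norm_le(2)[OF p _ le[of "e / 2"]] p_norm_nonneg[of p a] p_norm_nonneg[of p b]
      by simp
  qed
qed

lemma summable_powr_mono:
  fixes a b :: "nat \<Rightarrow> real"
  assumes "p \<ge> 1" "\<And>i. 0 \<le> a i" "\<And>i. a i \<le> b i" "summable (\<lambda>i. b i powr p)"
  shows "summable (\<lambda>i. a i powr p)"
  using assms by (intro summable_comparison_test'[OF assms(4), of 0]) (auto intro: powr_mono2)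

lemma p_norm_mono:
  assumes "p \<ge> 1" "\<And>i. 0 \<le> a i" "\<And>i. a i \<le> b i" "summable (\<lambda>i. b i powr p)"
  shows "p_norm p a \<le> p_norm p b"
proof (rule p_norm_le(2)[OF assms(1) p_norm_nonneg])
  fix n
  have "(\<Sum>i<n. a i powr p) \<le> (\<Sum>i<n. b i powr p)"
    using assms by (intro sum_mono powr_mono2) auto
  then show "(\<Sum>i<n. a i powr p) \<le> p_norm p b powr p"
    using sum_powr_le_p_norm[OF assms(1,4), of "{..<n}"] by simp
qed

section \<open>The metric on \<open>lp_plus p\<close>\<close>

text \<open>Nonnegativity gives domination by \<open>x i + y i\<close>, whose powers are summable by
  Minkowski.\<close>

lemma summable_diff_lp_plus:
  assumes "p \<ge> 1" "x \<in> lp_plus p" "y \<in> lp_plus p"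
  shows "summable (\<lambda>i. \<bar>x i - y i\<bar> powr p)"
proof (rule summable_powr_mono[OF assms(1)])
  show "summable (\<lambda>i. (x i + y i) powr p)"
    using assms by (intro p_norm_add) (auto simp: lp_plus_def)
  show "\<bar>x i - y i\<bar> \<le> x i + y i" for i
    using assms by (auto simp: lp_plus_def abs_le_iff)
qed auto

lemma abs_diff_le_lp_dist:
  assumes "p \<ge> 1" "x \<in> lp_plus p" "y \<in> lp_plus p"
  shows "\<bar>x i - y i\<bar> \<le> lp_dist p x y"
  unfolding lp_dist_eq_p_norm
  using le_p_norm[OF assms(1) summable_diff_lp_plus[OF assms]] by simp

lemma Metric_space_lp_plus:
  assumes p: "p \<ge> 1"
  shows "Metric_space (lp_plus p) (lp_dist p)"
proof
  fix x y
  show "0 \<le> lp_dist p x y"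
    by (simp add: lp_dist_eq_p_norm p_norm_nonneg)
  show "lp_dist p x y = lp_dist p y x"
    by (simp add: lp_dist_eq_p_norm abs_minus_commute)
next
  fix x y assume xy: "x \<in> lp_plus p" "y \<in> lp_plus p"
  show "lp_dist p x y = 0 \<longleftrightarrow> x = y"
  proof
    assume "lp_dist p x y = 0"
    then have "\<bar>x i - y i\<bar> \<le> 0" for i
      using abs_diff_le_lp_dist[OF p xy, of i] by simp
    then show "x = y" by auto
  qed (use p in \<open>simp add: lp_dist_eq_p_norm p_norm_def\<close>)
next
  fix x y z assume xyz: "x \<in> lp_plus p" "y \<in> lp_plus p" "z \<in> lp_plus p"
  note s = summable_diff_lp_plus[OF p]
  have "p_norm p (\<lambda>i. \<bar>x i - z i\<bar>) \<le> p_norm p (\<lambda>i. \<bar>x i - y i\<bar> + \<bar>y i - z i\<bar>)"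
    using xyz by (intro p_norm_mono p p_norm_add s) auto
  also have "\<dots> \<le> p_norm p (\<lambda>i. \<bar>x i - y i\<bar>) + p_norm p (\<lambda>i. \<bar>y i - z i\<bar>)"
    using xyz by (intro p_norm_add p s) auto
  finally show "lp_dist p x z \<le> lp_dist p x y + lp_dist p y z"
    by (simp add: lp_dist_eq_p_norm)
qed

section \<open>Completeness\<close>

text \<open>A partial sum of the distance involves finitely many coordinates, so coordinatewise
  convergence lets \<open>n\<close> tend to infinity in it. With \<open>x\<close> a late term of a
  Cauchy sequence \<open>y\<close>, this puts the limit in the space and close to
  \<open>x\<close>.\<close>

lemma lp_dist_limit_le:
  assumes p: "p \<ge> 1" and x: "x \<in> lp_plus p" and y: "\<And>n. y n \<in> lp_plus p"
    and lim: "\<And>i. (\<lambda>n. y n i) \<longlonglongrightarrow> l i"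
    and le: "\<And>n. n \<ge> N \<Longrightarrow> lp_dist p x (y n) \<le> e"
  shows "l \<in> lp_plus p" "lp_dist p x l \<le> e"
proof -
  have e: "0 \<le> e"
    using le[of N] p_norm_nonneg by (force simp: lp_dist_eq_p_norm intro: order_trans)
  have bound: "(\<Sum>i<k. \<bar>x i - l i\<bar> powr p) \<le> e powr p" for k
  proof (rule LIMSEQ_le_const2)
    \<comment> \<open>\<open>\<bar>x i - l i\<bar>\<close> may be 0; there continuity of
      \<open>powr\<close> in the base relies on \<open>p > 0\<close> and nonnegative bases.\<close>
    show "(\<lambda>n. \<Sum>i<k. \<bar>x i - y n i\<bar> powr p) \<longlonglongrightarrow> (\<Sum>i<k. \<bar>x i - l i\<bar> powr p)"
      using p by (intro tendsto_sum tendsto_powr' tendsto_intros lim) auto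
    have "(\<Sum>i<k. \<bar>x i - y n i\<bar> powr p) \<le> e powr p" if "n \<ge> N" for n
    proof -
      have "(\<Sum>i<k. \<bar>x i - y n i\<bar> powr p) \<le> lp_dist p x (y n) powr p"
        unfolding lp_dist_eq_p_norm
        by (intro sum_powr_le_p_norm summable_diff_lp_plus p x y) auto
      also have "\<dots> \<le> e powr p"
        using p le[OF that] by (intro powr_mono2) (auto simp: lp_dist_eq_p_norm p_norm_nonneg)
      finally show ?thesis .
    qed
    then show "\<exists>N. \<forall>n\<ge>N. (\<Sum>i<k. \<bar>x i - y n i\<bar> powr p) \<le> e powr p"
      by blast
  qed
  note diff = p_norm_le[where a = "\<lambda>i. \<bar>x i - l i\<bar>", OF p e bound]
  show "lp_dist p x l \<le> e"
    using diff(2) by (simp add: lp_dist_eq_p_norm)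
  have nonneg: "0 \<le> l i" for i
    using y by (intro LIMSEQ_le_const[OF lim]) (auto simp: lp_plus_def)
  \<comment> \<open>Compare with \<open>l i \<le> x i + \<bar>x i - l i\<bar>\<close>, a sum of two
    sequences with summable powers.\<close>
  have "summable (\<lambda>i. l i powr p)"
  proof (rule summable_powr_mono[OF p nonneg])
    show "summable (\<lambda>i. (x i + \<bar>x i - l i\<bar>) powr p)"
      using x diff(1) by (intro p_norm_add p) (auto simp: lp_plus_def)
  qed auto
  then show "l \<in> lp_plus p"
    using nonneg by (simp add: lp_plus_def)
qed

theorem theorem3p5:
  fixes p :: real
  assumes "p \<ge> 1"
  shows "Metric_space (lp_plus p) (lp_dist p) \<and>
    Metric_space.mcomplete (lp_plus p) (lp_dist p)"
proof
  show "Metric_space (lp_plus p) (lp_dist p)"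
    by (rule Metric_space_lp_plus[OF assms])
  then interpret Metric_space "lp_plus p" "lp_dist p" .
  show mcomplete
    unfolding mcomplete_def
  proof (intro allI impI)
    fix \<sigma> assume "MCauchy \<sigma>"
    then have mem: "\<sigma> n \<in> lp_plus p" for n
      by (auto simp: MCauchy_def)
    have cauchy: "\<exists>N. \<forall>m\<ge>N. \<forall>n\<ge>N. lp_dist p (\<sigma> m) (\<sigma> n) < e" if "e > 0" for e
      using \<open>MCauchy \<sigma>\<close> that unfolding MCauchy_def by meson
    \<comment> \<open>A coordinate difference is at most the distance.\<close>
    have "Cauchy (\<lambda>n. \<sigma> n i)" for i
    proof (rule metric_CauchyI)
      fix e :: real assume "e > 0"
      then obtain N where "\<forall>m\<ge>N. \<forall>n\<ge>N. lp_dist p (\<sigma> m) (\<sigma> n) < e"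
        using cauchy by blast
      then show "\<exists>N. \<forall>m\<ge>N. \<forall>n\<ge>N. dist (\<sigma> m i) (\<sigma> n i) < e"
        using abs_diff_le_lp_dist[OF assms mem mem, of _ i] unfolding dist_real_def
        by (meson le_less_trans)
    qed
    then have "\<exists>l. (\<lambda>n. \<sigma> n i) \<longlonglongrightarrow> l" for i
      using Cauchy_convergent convergent_def by blast
    then obtain l where lim: "\<And>i. (\<lambda>n. \<sigma> n i) \<longlonglongrightarrow> l i"
      by metis
    \<comment> \<open>Fix \<open>m\<close> and let \<open>n\<close> tend to infinity: the strict
      bound from \<open>cauchy\<close> survives as \<open>\<le> e\<close>. Membership of
      \<open>l\<close> comes along for any single \<open>e\<close>.\<close>
    have close: "\<exists>N. \<forall>m\<ge>N. l \<in> lp_plus p \<and> lp_dist p (\<sigma> m) l \<le> e" if e: "e > 0" for e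
    proof -
      obtain N where N: "\<And>m n. m \<ge> N \<Longrightarrow> n \<ge> N \<Longrightarrow> lp_dist p (\<sigma> m) (\<sigma> n) < e"
        using cauchy[OF e] by blast
      have "l \<in> lp_plus p" "lp_dist p (\<sigma> m) l \<le> e" if "m \<ge> N" for m
        using lp_dist_limit_le[where N = N and e = e, OF assms mem mem lim] N[OF that]
        by (auto intro: less_imp_le)
      then show ?thesis by blast
    qed
    have "limitin mtopology \<sigma> l sequentially"
      unfolding limit_metric_sequentially
    proof (intro conjI allI impI)
      show "l \<in> lp_plus p"
        using close[of 1] by auto
      fix e :: real assume "e > 0"
      \<comment> \<open>Halving \<open>e\<close> restores the strict inequality that convergence
        demands.\<close>
      then obtain N where "\<forall>m\<ge>N. lp_dist p (\<sigma> m) l \<le> e / 2"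
        using close[of "e / 2"] by auto
      then show "\<exists>N. \<forall>n\<ge>N. \<sigma> n \<in> lp_plus p \<and> lp_dist p (\<sigma> n) l < e"
        using \<open>e > 0\<close> mem by (intro exI[of _ N]) force
    qed
    then show "\<exists>l. limitin mtopology \<sigma> l sequentially" by blast
  qed
qed

end
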